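(* Let $n,n_t,d\ge 1$ be integers, let $A,M\in\mathbb R^{n\times n}$ and $F\in\mathbb R^{n\times n_t}$, and let $B_1,B_2\in\mathbb R^{n_t\times n_t}$ be lower triangular (banded) Toeplitz matrices, with $M$ and $B_2$ invertible. Let $\rho>0$ and, for $z\in\mathbb C$, let $\mathcal X_\rho(z)\in\mathbb C^{n\times n_t}$ denote the solution $X$ of the matrix equation $$A X (C_2^{(\rho z)})^T + M X (C_1^{(\rho z)})^T = F,$$ where $C_1^{(\alpha)}, C_2^{(\alpha)}$ are the $\alpha$-circulant modifications of $B_1,B_2$ (defined in the context). Suppose that there is $\widehat\rho>1$ such that this equation has a unique solution for every $z$ with $|z|<\widehat\rho$ and such that the matrix-valued function $\mathcal X_\rho$ is analytic on $\{z\in\mathbb C : |z|<\widehat\rho\}$. Let $\omega_j=\exp(2\pi \mathbf i j/d)$ for $j=0,\dots,d-1$ and define $$\widetilde X_0^{(d)} = \frac1d\sum_{j=0}^{d-1}\mathcal X_\rho(\omega_j).$$ Then for every $R\in(1,\widehat\rho)$, $$\bigl|(\mathcal X_\rho(0))_{ij}-(\widetilde X_0^{(d)})_{ij}\bigr|\le \frac{\max_{|z|=R}|(\mathcal X_\rho(z))_{ij}|}{R^d-1},\qquad i=1,\dots,n,\quad j=1,\dots,n_t.$$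
   Context: Here $\mathbf i$ is the imaginary unit and $(\cdot)^T$ is the transpose without conjugation. For a lower triangular Toeplitz matrix $B\in\mathbb R^{n_t\times n_t}$ with entries $B_{pq}=b_{p-q}$ for $p\ge q$ and $B_{pq}=0$ for $p<q$ (with $b_k=0$ for $k$ larger than the lower bandwidth of $B$), and for $\alpha\in\mathbb C$, its $\alpha$-circulant modification $C^{(\alpha)}$ is the matrix with entries $C^{(\alpha)}_{pq}=b_{p-q}$ for $p\ge q$ and $C^{(\alpha)}_{pq}=\alpha\, b_{n_t+p-q}$ for $p<q$. The matrices $C_1^{(\alpha)}$ and $C_2^{(\alpha)}$ are obtained in this way from $B_1$ and $B_2$, respectively. In particular $C_i^{(0)}=B_i$, so $\mathcal X_\rho(0)$ is the solution of $AXB_2^T+MXB_1^T=F$. The matrix $\widetilde X_0^{(d)}$ is the output, in exact arithmetic, of the evaluation-interpolation algorithm, which solves the modified equation for $\alpha=\rho\omega_j$, $j=0,\dots,d-1$, and averages the solutions; it is the value at $0$ of the polynomial of degree at most $d-1$ interpolating $\mathcal X_\rho$ at the $d$th roots of unity. Analyticity of a matrix-valued function means analyticity of each entry. *)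

theory Defs
  imports "HOL-Complex_Analysis.Complex_Analysis" "Jordan_Normal_Form.Matrix"
begin

definition lower_triangular_toeplitz :: "nat \<Rightarrow> 'a::zero mat \<Rightarrow> bool" where
  "lower_triangular_toeplitz m B \<longleftrightarrow>
     B \<in> carrier_mat m m \<and>
     (\<exists>b :: nat \<Rightarrow> 'a. \<forall>p<m. \<forall>q<m. B $$ (p, q) = (if q \<le> p then b (p - q) else 0))"

text \<open>For a lower triangular Toeplitz matrix \<open>B\<close> the entry in row \<open>k\<close> (from 0) of the first column
  is the coefficient \<open>b\<^sub>k\<close>; it vanishes for \<open>k\<close> beyond the lower bandwidth.
  Every lower triangular matrix has some lower bandwidth below its size, so bandedness
  is not a separate condition.\<close>

definition circulant_mod :: "complex \<Rightarrow> real mat \<Rightarrow> complex mat" where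
  "circulant_mod \<alpha> B = Matrix.mat (dim_row B) (dim_row B) (\<lambda>(p, q).
     if q \<le> p then complex_of_real (B $$ (p - q, 0))
     else \<alpha> * complex_of_real (B $$ (dim_row B + p - q, 0)))"

definition solves_modified_eq ::
    "nat \<Rightarrow> nat \<Rightarrow> real mat \<Rightarrow> real mat \<Rightarrow> real mat \<Rightarrow> real mat \<Rightarrow> real mat \<Rightarrow> complex \<Rightarrow> complex mat \<Rightarrow> bool"
  where
  "solves_modified_eq n nt A M B1 B2 F \<alpha> X \<longleftrightarrow>
     X \<in> carrier_mat n nt \<and>
     map_mat complex_of_real A * X * transpose_mat (circulant_mod \<alpha> B2)
       + map_mat complex_of_real M * X * transpose_mat (circulant_mod \<alpha> B1)
     = map_mat complex_of_real F"

text \<open>The value is meaningful only where the equation is uniquely solvable.\<close>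

definition modified_solution ::
    "nat \<Rightarrow> nat \<Rightarrow> real mat \<Rightarrow> real mat \<Rightarrow> real mat \<Rightarrow> real mat \<Rightarrow> real mat \<Rightarrow> real \<Rightarrow> complex \<Rightarrow> complex mat"
  where
  "modified_solution n nt A M B1 B2 F \<rho> z =
     (THE X. solves_modified_eq n nt A M B1 B2 F (complex_of_real \<rho> * z) X)"

definition root_unity :: "nat \<Rightarrow> nat \<Rightarrow> complex" where
  "root_unity d j = exp (2 * complex_of_real pi * \<i> * of_nat j / of_nat d)"

definition averaged_solution ::
    "nat \<Rightarrow> nat \<Rightarrow> nat \<Rightarrow> (complex \<Rightarrow> complex mat) \<Rightarrow> complex mat" where
  "averaged_solution n nt d X = Matrix.mat n nt (\<lambda>(i, j).
     (1 / of_nat d) * (\<Sum>k<d. X (root_unity d k) $$ (i, j)))"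

end

theory Submission imports Defs
begin

text \<open>Averaging over the \<open>d\<close>th roots of unity annihilates every Taylor monomial \<open>z\<^sup>m\<close> with
  \<open>d \<nmid> m\<close> and fixes the others at \<open>1\<close>. So the error at \<open>0\<close> is the sum of the
  Taylor coefficients of index \<open>d, 2d, 3d, \<dots>\<close>, which Cauchy's inequality on the circle of radius
  \<open>R\<close> bounds by a geometric series with ratio \<open>R\<^sup>-\<^sup>d\<close>.\<close>

lemma norm_root_unity [simp]: "norm (root_unity d k) = 1"
  by (simp add: root_unity_def norm_exp_eq_Re)

text \<open>The exponent in \<open>root_unity d k ^ m\<close> is symmetric in \<open>k\<close> and
  \<open>m\<close>, so the sum is geometric with ratio \<open>w = root_unity d m\<close>. As
  \<open>w ^ d = 1\<close>, it vanishes unless \<open>w = 1\<close>.\<close>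

lemma sum_root_unity_power:
  assumes "d \<ge> 1"
  shows "(\<Sum>k<d. root_unity d k ^ m) = (if d dvd m then of_nat d else 0)"
proof -
  define w where "w = root_unity d m"
  have pow: "root_unity d k ^ m = w ^ k" for k
    by (simp add: w_def root_unity_def mult_ac flip: exp_of_nat_mult)
  have w1: "w = 1 \<longleftrightarrow> d dvd m"
    unfolding w_def root_unity_def using complex_root_unity_eq_1[OF assms, of m] by simp
  have wd: "w ^ d = 1"
    unfolding w_def root_unity_def using complex_root_unity[of d m] assms by simp
  show ?thesis
  proof (cases "d dvd m")
    case True
    then show ?thesis using w1 pow by simp
  next
    case False
    then show ?thesis using w1 wd pow by (simp add: sum_gp_strict)
  qed
qed

text \<open>Scalar form of the estimate, applied later to each matrix entry. An arbitrary bound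
  \<open>K\<close> on the circle keeps suprema out of the series argument.\<close>

lemma average_roots_unity_error:
  assumes holf: "f holomorphic_on ball 0 r" and R: "1 < R" "R < r" and d: "d \<ge> 1"
    and bound: "\<And>z. norm z = R \<Longrightarrow> norm (f z) \<le> K"
  shows "norm (f 0 - (1 / of_nat d) * (\<Sum>k<d. f (root_unity d k))) \<le> K / (R ^ d - 1)"
proof -
  define a where "a = (\<lambda>m. (deriv ^^ m) f 0 / fact m)"
  define S where "S = (1 / of_nat d) * (\<Sum>k<d. f (root_unity d k))"
  have a0: "a 0 = f 0"
    by (simp add: a_def)
  have norm_a: "norm (a m) \<le> K / R ^ m" for m
  proof -
    \<comment> \<open>Cauchy's inequality needs continuity up to the circle; \<open>R < r\<close>
      puts the closed disc inside the domain.\<close>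
    have "f holomorphic_on ball 0 R" "continuous_on (cball 0 R) f"
      using holf R by (auto intro: holomorphic_on_subset
          intro!: holomorphic_on_imp_continuous_on)
    then have "norm ((deriv ^^ m) f 0) \<le> fact m * K / R ^ m"
      using R by (intro Cauchy_inequality) (auto intro: bound)
    then show ?thesis
      by (simp add: a_def norm_divide field_simps)
  qed
  \<comment> \<open>The roots have modulus 1 < r, so the Taylor series at 0 converges there.\<close>
  have "(\<lambda>m. a m * root_unity d k ^ m) sums f (root_unity d k)" for k
    using holomorphic_power_series[OF holf, of "root_unity d k"] R by (simp add: a_def)
  then have "(\<lambda>m. (1 / of_nat d) * (\<Sum>k<d. a m * root_unity d k ^ m)) sums S"
    unfolding S_def by (intro sums_mult sums_sum) auto
  also have "(\<lambda>m. (1 / of_nat d) * (\<Sum>k<d. a m * root_unity d k ^ m))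
      = (\<lambda>m. if d dvd m then a m else 0)"
    using d by (auto simp: sum_root_unity_power simp flip: sum_distrib_left)
  finally have "(\<lambda>m. if d dvd m then a m else 0) sums S" .
  moreover have "strict_mono (\<lambda>l. d * l)"
    using d by (auto intro: strict_monoI)
  \<comment> \<open>Only zero terms lie outside the range of \<open>l \<mapsto> d * l\<close>, so
    skipping them keeps the sum.\<close>
  ultimately have "(\<lambda>l. if d dvd d * l then a (d * l) else 0) sums S"
    by (subst sums_mono_reindex) (auto simp: dvd_def)
  then have "(\<lambda>l. a (d * l)) sums S"
    by simp
  \<comment> \<open>The term for \<open>l = 0\<close> is \<open>f 0\<close>; removing it leaves the
    error up to sign.\<close>
  then have tail: "(\<lambda>l. a (d * Suc l)) sums (S - f 0)"
    using sums_Suc_iff[of "\<lambda>l. a (d * l)" "S - f 0"] a0 by simp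
  have Rd: "R ^ d > 1"
    using R d by simp
  \<comment> \<open>The majorant starts at \<open>K / R ^ d\<close> because the tail starts at index
    \<open>d\<close>.\<close>
  have "(\<lambda>l. K / R ^ d * (1 / R ^ d) ^ l) sums (K / R ^ d * (1 / (1 - 1 / R ^ d)))"
    using Rd by (intro sums_mult geometric_sums) auto
  moreover have "K / R ^ d * (1 / (1 - 1 / R ^ d)) = K / (R ^ d - 1)"
    using Rd R by (simp add: field_simps)
  moreover have "K / R ^ d * (1 / R ^ d) ^ l = K / R ^ (d * Suc l)" for l
    by (simp add: power_add power_mult power_divide)
  ultimately have geo: "(\<lambda>l. K / R ^ (d * Suc l)) sums (K / (R ^ d - 1))"
    by (simp only:)
  have "norm (S - f 0) \<le> K / (R ^ d - 1)"
    using norm_sums_le[OF tail geo] norm_a by blast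
  then show ?thesis
    by (simp add: S_def norm_minus_commute)
qed

theorem theorem3:
  fixes n nt d :: nat
    and A M F B1 B2 :: "real mat"
    and \<rho> \<rho>hat R :: real
    and X :: "complex \<Rightarrow> complex mat"
  assumes "n \<ge> 1" and "nt \<ge> 1" and "d \<ge> 1"
    and "A \<in> carrier_mat n n" and "M \<in> carrier_mat n n" and "F \<in> carrier_mat n nt"
    and "lower_triangular_toeplitz nt B1" and "lower_triangular_toeplitz nt B2"
    and "invertible_mat M" and "invertible_mat B2"
    and "\<rho> > 0" and "\<rho>hat > 1"
    and X_def: "X = modified_solution n nt A M B1 B2 F \<rho>"
    and "\<And>z. cmod z < \<rho>hat \<Longrightarrow>
           \<exists>!Y. solves_modified_eq n nt A M B1 B2 F (complex_of_real \<rho> * z) Y"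
    and "\<And>i j. i < n \<Longrightarrow> j < nt \<Longrightarrow>
           (\<lambda>z. X z $$ (i, j)) analytic_on {z. cmod z < \<rho>hat}"
    and "1 < R" and "R < \<rho>hat"
  shows "\<forall>i<n. \<forall>j<nt.
           cmod (X 0 $$ (i, j) - averaged_solution n nt d X $$ (i, j))
             \<le> (SUP z\<in>{z. cmod z = R}. cmod (X z $$ (i, j))) / (R ^ d - 1)"
proof (intro allI impI)
  fix i j
  assume ij: "i < n" "j < nt"
  let ?f = "\<lambda>z. X z $$ (i, j)"
  have hol: "?f holomorphic_on ball 0 \<rho>hat"
    using assms(15)[OF ij] by (simp add: ball_def analytic_imp_holomorphic)
  \<comment> \<open>A real \<open>SUP\<close> is sure to dominate the values only if they are
    bounded above; continuity on the compact circle gives this.\<close>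
  have circle: "{z. cmod z = R} = sphere 0 R"
    by auto
  have "continuous_on (sphere 0 R) ?f"
    using hol \<open>R < \<rho>hat\<close>
    by (auto intro: holomorphic_on_subset intro!: holomorphic_on_imp_continuous_on)
  then have "compact ((\<lambda>z. cmod (?f z)) ` sphere 0 R)"
    by (intro compact_continuous_image continuous_intros) auto
  then have bdd: "bdd_above ((\<lambda>z. cmod (?f z)) ` sphere 0 R)"
    by (intro bounded_imp_bdd_above compact_imp_bounded)
  have "norm (?f 0 - (1 / of_nat d) * (\<Sum>k<d. ?f (root_unity d k)))
      \<le> (SUP z\<in>{z. cmod z = R}. cmod (?f z)) / (R ^ d - 1)"
    unfolding circle
    by (rule average_roots_unity_error[OF hol \<open>1 < R\<close> \<open>R < \<rho>hat\<close> \<open>d \<ge> 1\<close>])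
      (use bdd in \<open>auto intro!: cSUP_upper\<close>)
  then show "cmod (X 0 $$ (i, j) - averaged_solution n nt d X $$ (i, j))
      \<le> (SUP z\<in>{z. cmod z = R}. cmod (X z $$ (i, j))) / (R ^ d - 1)"
    using ij by (simp add: averaged_solution_def)
qed

end
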